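(* Let $n\ge 0$ and let $Z_n$ be the number of zeros of a random lattice path $W_n$ of length $n$ (as described in the context). Then \[ \mathbb{E}[Z_n] = \frac{4}{n+1}\sum_{0\le k<\ell<\lceil n/2\rceil}\frac{\binom nk}{\binom n\ell} + [n\text{ even}]\,\frac1{n+1}\Bigl(\frac{2^n}{\binom{n}{n/2}}-1\Bigr) + 1. \]
   Context: Random lattice path model: a path $W_n$ of length $n$ starts at $(0,0)$ and uses steps $(1,+1)$ and $(1,-1)$. First an endpoint $(n,D)$ is chosen with $D$ uniformly distributed on $\{-n,-n+2,\dots,n-2,n\}$; then a path is chosen uniformly at random among all such paths from $(0,0)$ to $(n,D)$. A zero of the path is a point $(x,0)$ on it (including the origin). $[P]=1$ if $P$ is true and $0$ otherwise. *)

theory Defs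
  imports "HOL-Probability.Probability"
begin

(* A path starting at (0,0) is encoded by the list of the vertical components of its
   steps: 1 stands for the step (1,+1) and -1 for the step (1,-1). *)

definition path_point :: "int list \<Rightarrow> nat \<Rightarrow> int \<times> int" where
  "path_point w i = (int i, sum_list (take i w))"

definition path_points :: "int list \<Rightarrow> (int \<times> int) set" where
  "path_points w = path_point w ` {0..length w}"

definition lattice_paths :: "nat \<Rightarrow> int \<Rightarrow> int list set" where
  "lattice_paths n D =
     {w. length w = n \<and> set w \<subseteq> {1, -1} \<and> path_point w n = (int n, D)}"

definition endpoint_heights :: "nat \<Rightarrow> int set" where
  "endpoint_heights n = (\<lambda>i. - int n + 2 * int i) ` {0..n}"

definition random_path :: "nat \<Rightarrow> int list pmf" where
  "random_path n = do {
     D \<leftarrow> pmf_of_set (endpoint_heights n);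
     pmf_of_set (lattice_paths n D)
   }"

definition path_zeros :: "int list \<Rightarrow> (int \<times> int) set" where
  "path_zeros w = {p \<in> path_points w. snd p = 0}"

definition num_zeros :: "int list \<Rightarrow> nat" where
  "num_zeros w = card (path_zeros w)"

(* pmf_of_set is the uniform distribution only on finite nonempty sets; the following
   lemmas show that it is used in this regime in random_path. *)

lemma finite_endpoint_heights: "finite (endpoint_heights n)"
  by (simp add: endpoint_heights_def)

lemma endpoint_heights_nonempty: "endpoint_heights n \<noteq> {}"
  by (simp add: endpoint_heights_def)

lemma finite_lattice_paths: "finite (lattice_paths n D)"
proof -
  have "finite {w :: int list. set w \<subseteq> {1, -1} \<and> length w = n}"
    by (rule finite_lists_length_eq) simp
  then show ?thesis
    by (rule rev_finite_subset) (auto simp: lattice_paths_def)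
qed

lemma lattice_paths_nonempty:
  assumes "D \<in> endpoint_heights n"
  shows "lattice_paths n D \<noteq> {}"
proof -
  from assms obtain i where i: "i \<le> n" and D: "D = - int n + 2 * int i"
    by (auto simp: endpoint_heights_def)
  have "replicate i 1 @ replicate (n - i) (-1) \<in> lattice_paths n D"
    using i by (auto simp: lattice_paths_def path_point_def D sum_list_replicate of_nat_diff)
  then show ?thesis
    by blast
qed

lemma finite_path_zeros: "finite (path_zeros w)"
  by (simp add: path_zeros_def path_points_def)

end

theory Submission
  imports Defs
begin

text \<open>
  Let \<open>A n D\<close> be the total number of zeros of all paths to \<open>(n, D)\<close>. Removing the last step gives
  \<open>A (n+1) D = A n (D-1) + A n (D+1) + [D = 0] card (lattice_paths (n+1) D)\<close>. For
  \<open>D = 2u - n \<le> 0\<close>, this is Pascal's recurrence of \<open>(n choose u) + 2 (\<Sum>k<u. n choose k)\<close>: at \<open>D = 0\<close>,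
  where \<open>D + 1\<close> leaves the half-plane, \<open>A n 1 = A n (-1)\<close> by reflection and the correction term
  makes up for the difference. Averaging over the endpoints and folding the sum by the
  reflection \<open>D \<mapsto> -D\<close> gives the formula.
\<close>

lemma path_points_snoc:
  "path_points (w @ [s]) = insert (int (length w) + 1, sum_list w + s) (path_points w)"
proof -
  have "path_point (w @ [s]) ` {0..length w} = path_point w ` {0..length w}"
    by (rule image_cong) (auto simp: path_point_def)
  then show ?thesis
    by (simp add: path_points_def atLeast0_atMost_Suc) (simp add: path_point_def add.commute)
qed

lemma num_zeros_snoc:
  "num_zeros (w @ [s]) = num_zeros w + of_bool (sum_list w + s = 0)"
proof -
  \<comment> \<open>The new point lies to the right of all points of \<open>w\<close>.\<close>
  have "(int (length w) + 1, sum_list w + s) \<notin> path_zeros w"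
    by (auto simp: path_zeros_def path_points_def path_point_def)
  moreover have "path_zeros (w @ [s]) =
    (if sum_list w + s = 0 then insert (int (length w) + 1, sum_list w + s) (path_zeros w)
     else path_zeros w)"
    by (auto simp: path_zeros_def path_points_snoc)
  ultimately show ?thesis
    by (auto simp: num_zeros_def finite_path_zeros)
qed

lemma num_zeros_Nil: "num_zeros [] = 1"
  by (simp add: num_zeros_def path_zeros_def path_points_def path_point_def Collect_conv_if)

lemma lattice_paths_0: "lattice_paths 0 D = (if D = 0 then {[]} else {})"
  by (auto simp: lattice_paths_def path_point_def)

lemma lattice_paths_Suc:
  "lattice_paths (Suc n) D =
     (\<lambda>w. w @ [1]) ` lattice_paths n (D - 1) \<union> (\<lambda>w. w @ [-1]) ` lattice_paths n (D + 1)"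
  (is "?L = ?R")
proof
  show "?L \<subseteq> ?R"
  proof
    fix w assume w: "w \<in> ?L"
    then obtain v s where "w = v @ [s]"
      by (cases w rule: rev_cases) (auto simp: lattice_paths_def)
    with w show "w \<in> ?R"
      by (auto simp: lattice_paths_def path_point_def image_iff)
  qed
  show "?R \<subseteq> ?L"
    by (auto simp: lattice_paths_def path_point_def)
qed

lemma sum_lattice_paths_Suc:
  "sum f (lattice_paths (Suc n) D) =
     (\<Sum>w\<in>lattice_paths n (D - 1). f (w @ [1])) + (\<Sum>w\<in>lattice_paths n (D + 1). f (w @ [-1]))"
  unfolding lattice_paths_Suc
  by (subst sum.union_disjoint)
     (auto simp: finite_lattice_paths sum.reindex inj_on_def)

text \<open>Settles the lowest endpoint \<open>u = 0\<close> in the inductions below, where the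
  recurrence refers to the height \<open>- n - 2\<close>, out of reach in \<open>n\<close>
  steps.\<close>

lemma lattice_paths_empty:
  assumes "D < - int n"
  shows "lattice_paths n D = {}"
  using assms by (induction n arbitrary: D) (auto simp: lattice_paths_0 lattice_paths_Suc)

lemma card_lattice_paths_Suc:
  "card (lattice_paths (Suc n) D) = card (lattice_paths n (D - 1)) + card (lattice_paths n (D + 1))"
  unfolding card_eq_sum by (rule sum_lattice_paths_Suc)

text \<open>Here \<open>u\<close> is the number of up-steps, and splitting by the last step is
  Pascal's rule. For \<open>u > n\<close> both sides are 0, so the induction has a boundary case
  only at \<open>u = 0\<close>.\<close>

lemma card_lattice_paths: "card (lattice_paths n (2 * int u - int n)) = n choose u"
proof (induction n arbitrary: u)
  case 0
  then show ?case by (cases u) (auto simp: lattice_paths_0)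
next
  case (Suc n)
  show ?case
  proof (cases u)
    case 0
    then show ?thesis
      using Suc.IH[of 0] by (simp add: card_lattice_paths_Suc lattice_paths_empty)
  next
    case (Suc v)
    then show ?thesis
      using Suc.IH[of v] Suc.IH[of "Suc v"]
      by (simp add: card_lattice_paths_Suc algebra_simps)
  qed
qed

definition total_zeros :: "nat \<Rightarrow> int \<Rightarrow> nat" where
  "total_zeros n D = (\<Sum>w\<in>lattice_paths n D. num_zeros w)"

lemma sum_list_lattice_paths: "w \<in> lattice_paths n D \<Longrightarrow> sum_list w = D"
  by (auto simp: lattice_paths_def path_point_def)

lemma total_zeros_0: "total_zeros 0 D = of_bool (D = 0)"
  by (simp add: total_zeros_def lattice_paths_0 num_zeros_Nil)

lemma total_zeros_Suc:
  "total_zeros (Suc n) D = total_zeros n (D - 1) + total_zeros n (D + 1)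
     + of_bool (D = 0) * card (lattice_paths (Suc n) D)"
  by (simp add: total_zeros_def sum_lattice_paths_Suc num_zeros_snoc sum_list_lattice_paths
      sum.distrib card_lattice_paths_Suc cong: sum.cong)

text \<open>Reflection in the horizontal axis preserves zeros. In the recurrence it swaps the first
  two summands, and the correction term occurs only at the fixed height 0.\<close>

lemma total_zeros_uminus: "total_zeros n (- D) = total_zeros n D"
proof (induction n arbitrary: D)
  case 0
  then show ?case by (simp add: total_zeros_0)
next
  case (Suc n)
  show ?case
    using Suc.IH[of "D - 1"] Suc.IH[of "D + 1"] by (cases "D = 0") (simp_all add: total_zeros_Suc add.commute)
qed

text \<open>Pascal's rule summed over \<open>k\<close>: partial row sums satisfy the same recurrence
  as the binomials.\<close>

lemma sum_choose_Suc:
  "(\<Sum>k<Suc u. Suc n choose k) = (\<Sum>k<Suc u. n choose k) + (\<Sum>k<u. n choose k)"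
  by (induction u) auto

lemma total_zeros_eq:
  assumes "2 * u \<le> n"
  shows "total_zeros n (2 * int u - int n) = (n choose u) + 2 * (\<Sum>k<u. n choose k)"
  using assms
proof (induction n arbitrary: u)
  case 0
  then show ?case by (simp add: total_zeros_0)
next
  case (Suc n)
  show ?case
  proof (cases u)
    case 0
    have "total_zeros n (- 2 - int n) = 0"
      by (simp add: total_zeros_def lattice_paths_empty)
    then show ?thesis
      using 0 Suc.IH[of 0] by (simp add: total_zeros_Suc)
  next
    case (Suc v)
    have rec: "total_zeros (Suc n) (2 * int u - int (Suc n)) =
      total_zeros n (2 * int v - int n) + total_zeros n (2 * int (Suc v) - int n)
      + of_bool (2 * u = Suc n) * (Suc n choose u)"
      unfolding total_zeros_Suc card_lattice_paths using Suc by (auto simp: algebra_simps)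
    have v: "total_zeros n (2 * int v - int n) = (n choose v) + 2 * (\<Sum>k<v. n choose k)"
      using Suc.prems Suc by (intro Suc.IH) simp
    show ?thesis
    proof (cases "2 * u = Suc n")
      case True
      have "total_zeros n (2 * int (Suc v) - int n) = total_zeros n (2 * int v - int n)"
      proof -
        have "2 * int (Suc v) - int n = - (2 * int v - int n)"
          using True Suc by simp
        then show ?thesis
          by (simp only: total_zeros_uminus)
      qed
      \<comment> \<open>The correction term supplies \<open>Suc n choose u\<close>; the doubled
        value at height -1 is twice the partial sum of row \<open>Suc n\<close>.\<close>
      then show ?thesis
        using rec v True sum_choose_Suc[of n v] Suc by simp
    next
      case False
      then have "total_zeros n (2 * int (Suc v) - int n)
          = (n choose Suc v) + 2 * (\<Sum>k<Suc v. n choose k)"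
        using Suc.prems Suc by (intro Suc.IH) simp
      then show ?thesis
        using rec v False sum_choose_Suc[of n v] Suc by simp
    qed
  qed
qed

text \<open>Conditioning on the endpoint: each of the \<open>n + 1\<close> heights has the same
  weight, and the mean for a given height is the total divided by the number of paths.\<close>

lemma expectation_num_zeros:
  "measure_pmf.expectation (random_path n) (\<lambda>w. real (num_zeros w)) =
     (\<Sum>u\<le>n. real (total_zeros n (2 * int u - int n)) / real (n choose u)) / (real n + 1)"
proof -
  have inj: "inj_on (\<lambda>i. - int n + 2 * int i) {0..n}"
    by (auto simp: inj_on_def)
  have card: "card (endpoint_heights n) = n + 1"
    unfolding endpoint_heights_def by (subst card_image[OF inj]) simp
  have cond: "measure_pmf.expectation (pmf_of_set (lattice_paths n D)) (\<lambda>w. real (num_zeros w))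
      = real (total_zeros n D) / real (card (lattice_paths n D))" if "D \<in> endpoint_heights n" for D
    using that by (simp add: integral_pmf_of_set lattice_paths_nonempty finite_lattice_paths
        total_zeros_def)
  have "measure_pmf.expectation (random_path n) (\<lambda>w. real (num_zeros w)) =
     (\<Sum>D\<in>endpoint_heights n. measure_pmf.expectation (pmf_of_set (lattice_paths n D))
        (\<lambda>w. real (num_zeros w)) / (real n + 1))"
    unfolding random_path_def
    by (subst pmf_expectation_bind_pmf_of_set)
       (auto simp: finite_endpoint_heights endpoint_heights_nonempty lattice_paths_nonempty
         finite_lattice_paths card divide_inverse add.commute mult.commute)
  also have "\<dots> = (\<Sum>D\<in>endpoint_heights n.
      real (total_zeros n D) / real (card (lattice_paths n D)) / (real n + 1))"
    by (simp add: cond)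
  also have "\<dots> = (\<Sum>u\<in>{0..n}. real (total_zeros n (2 * int u - int n)) / real (n choose u)
      / (real n + 1))"
    unfolding endpoint_heights_def
    by (subst sum.reindex[OF inj]) (simp add: card_lattice_paths[symmetric] algebra_simps)
  finally show ?thesis
    by (simp add: sum_divide_distrib atLeast0AtMost)
qed

lemma sum_fold:
  fixes f :: "nat \<Rightarrow> real"
  assumes "\<And>u. u \<le> n \<Longrightarrow> f (n - u) = f u"
  shows "(\<Sum>u\<le>n. f u) = 2 * (\<Sum>u<(n + 1) div 2. f u) + of_bool (even n) * f (n div 2)"
proof -
  let ?h = "(n + 1) div 2"
  have "(\<Sum>u\<in>{n - ?h<..n}. f u) = (\<Sum>u<?h. f u)"
    by (rule sum.reindex_bij_witness[of _ "\<lambda>u. n - u" "\<lambda>u. n - u"]) (auto simp: assms)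
  \<comment> \<open>For even \<open>n\<close> the middle index is its own mirror image and belongs
    to neither half.\<close>
  moreover have "{..n} = {..<?h} \<union> {n - ?h<..n} \<union> (if even n then {n div 2} else {})"
    by (auto elim!: evenE oddE)
  moreover have "{..<?h} \<inter> {n - ?h<..n} = {}"
    by auto
  ultimately show ?thesis
    by (auto simp: sum.union_disjoint elim!: evenE)
qed

text \<open>At \<open>u = m\<close> the formula counts the central entry of row \<open>2 * m\<close>
  once and the left half twice, which by symmetry is the whole row.\<close>

lemma total_zeros_centre: "total_zeros (2 * m) 0 = 2 ^ (2 * m)"
proof -
  have "(\<Sum>k\<in>{m<..2 * m}. 2 * m choose k) = (\<Sum>k<m. 2 * m choose k)"
    by (rule sum.reindex_bij_witness[of _ "\<lambda>k. 2 * m - k" "\<lambda>k. 2 * m - k"])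
       (auto simp: binomial_symmetric[symmetric])
  moreover have "{..2 * m} = insert m ({..<m} \<union> {m<..2 * m})"
    by auto
  moreover have "(\<Sum>k\<in>insert m ({..<m} \<union> {m<..2 * m}). 2 * m choose k) =
      (2 * m choose m) + ((\<Sum>k<m. 2 * m choose k) + (\<Sum>k\<in>{m<..2 * m}. 2 * m choose k))"
    by (subst sum.insert) (auto intro!: sum.union_disjoint)
  ultimately show ?thesis
    using total_zeros_eq[of m "2 * m"] choose_row_sum[of "2 * m"] by simp
qed

theorem theorem5p1:
  fixes n :: nat
  shows "measure_pmf.expectation (random_path n) (\<lambda>w. real (num_zeros w)) =
    4 / (real n + 1) *
      (\<Sum>(k, l)\<in>{(k, l). 0 \<le> k \<and> k < l \<and> int l < \<lceil>real n / 2\<rceil>}.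
         real (n choose k) / real (n choose l))
    + of_bool (even n) * (1 / (real n + 1)) * (2 ^ n / real (n choose (n div 2)) - 1)
    + 1"
proof -
  \<comment> \<open>For \<open>u \<le> n\<close> this is the mean number of zeros given
    \<open>u\<close> up-steps.\<close>
  define f where "f u = real (total_zeros n (2 * int u - int n)) / real (n choose u)" for u
  define h where "h = (n + 1) div 2"
  define S where "S = (\<Sum>l<h. \<Sum>k<l. real (n choose k) / real (n choose l))"
  have ceil: "\<lceil>real n / 2\<rceil> = int h"
    unfolding h_def by (rule ceiling_unique) (auto simp: field_simps elim!: evenE oddE)
  \<comment> \<open>With \<open>l\<close> as the outer index, the inner sum over \<open>k\<close> is
    the one that occurs in \<open>f l\<close>.\<close>
  have "{(k, l). 0 \<le> k \<and> k < l \<and> int l < \<lceil>real n / 2\<rceil>} = prod.swap ` (SIGMA l:{..<h}. {..<l})"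
    by (auto simp: ceil image_iff)
  then have S: "(\<Sum>(k, l)\<in>{(k, l). 0 \<le> k \<and> k < l \<and> int l < \<lceil>real n / 2\<rceil>}.
         real (n choose k) / real (n choose l)) = S"
    unfolding S_def by (simp add: sum.reindex sum.Sigma case_prod_unfold)
  have "f (n - u) = f u" if "u \<le> n" for u
    using that total_zeros_uminus[of n "2 * int u - int n"] binomial_symmetric[OF that]
    by (simp add: f_def of_nat_diff algebra_simps)
  then have "(\<Sum>u\<le>n. f u) = 2 * (\<Sum>u<h. f u) + of_bool (even n) * f (n div 2)"
    unfolding h_def by (rule sum_fold)
  also have "(\<Sum>u<h. f u) = real h + 2 * S"
  proof -
    have "f u = 1 + 2 * (\<Sum>k<u. real (n choose k) / real (n choose u))" if "u < h" for u
    proof -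
      from that have "2 * u \<le> n" by (auto simp: h_def)
      then show ?thesis
        by (simp add: f_def total_zeros_eq add_divide_distrib flip: sum_divide_distrib)
    qed
    then show ?thesis
      by (simp add: S_def sum.distrib sum_distrib_left)
  qed
  \<comment> \<open>For odd \<open>n\<close>, \<open>2 * h = n + 1\<close>; for even
    \<open>n\<close>, \<open>2 * h = n\<close>, and writing \<open>n\<close> as
    \<open>(n + 1) - 1\<close> produces the \<open>- 1\<close> beside the central mean. Division by
    \<open>n + 1\<close> later turns \<open>n + 1\<close> into the final summand 1.\<close>
  also have "2 * (real h + 2 * S) + of_bool (even n) * f (n div 2) =
    real n + 1 + 4 * S + of_bool (even n) * (2 ^ n / real (n choose (n div 2)) - 1)"
    by (auto simp: f_def h_def total_zeros_centre elim!: evenE oddE)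
  finally have "(\<Sum>u\<le>n. f u) =
    real n + 1 + 4 * S + of_bool (even n) * (2 ^ n / real (n choose (n div 2)) - 1)" .
  then show ?thesis
    unfolding expectation_num_zeros S f_def[symmetric] by (simp add: add_divide_distrib)
qed

end
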